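(* Let $\mathbb G=(G,\partial G,E,\mu,g)$ and $\mathbb G'=(G',\partial G',E',\mu',g')$ be two finite, strongly connected, weighted graphs with nonempty boundary, both satisfying the Two-Points Condition and the Boundary-Triangle Condition (defined in the context). Let $q:G\to\mathbb R$ and $q':G'\to\mathbb R$ be potential functions, and suppose $(\mathbb G,q)$ is spectrally isomorphic to $(\mathbb G',q')$ with a boundary-isomorphism $\Phi_0$. Let $\Phi:G\cup\partial G\to G'\cup\partial G'$ be a bijection such that $\Phi|_{\partial G}=\Phi_0|_{\partial G}$ and, for all vertices $x_1,x_2$ of $\mathbb G$, $x_1\sim x_2$ if and only if $\Phi(x_1)\sim'\Phi(x_2)$ (such $\Phi$ exists under these assumptions), and identify vertices of $\mathbb G$ with vertices of $\mathbb G'$ via $\Phi$. Assume furthermore that $\mu_z=\mu'_z$ for all $z\in\partial G$ and $g_{xz}=g'_{xz}$ for all $z\in\partial G$, $x\in G$ with $x\sim z$. Then: (1) If $\mu=\mu'$, then $g_{xy}=g'_{xy}$ for every edge $\{x,y\}\in E$ having at least one endpoint in $G$, and $q=q'$. (2) If $q=q'=0$, then $\mu=\mu'$ and $g_{xy}=g'_{xy}$ for every edge $\{x,y\}\in E$ having at least one endpoint in $G$. In particular, if $\mu=\deg_{\mathbb G}$ and $\mu'=\deg_{\mathbb G'}$, then $g_{xy}=g'_{xy}$ for every edge $\{x,y\}\in E$ having at least one endpoint in $G$, and $q=q'$.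
   Context: A weighted graph with boundary $\mathbb G=(G,\partial G,E,\mu,g)$ consists of disjoint sets $G$ (interior vertices) and $\partial G$ (boundary vertices), a set $E$ of two-element subsets of $G\cup\partial G$ (edges; the graph $(G\cup\partial G,E)$ is undirected and simple), a vertex weight $\mu:G\cup\partial G\to(0,\infty)$ and an edge weight $g:E\to(0,\infty)$. Write $x\sim y$ if $\{x,y\}\in E$ ($\sim'$ is the edge relation of $\mathbb G'$), $g_{xy}=g_{yx}$ for the weight of that edge, $\mu_x=\mu(x)$. $\deg_{\mathbb G}(x)$ is the number of vertices joined to $x$ by an edge of $E$. $\mathbb G$ is finite (connected) if $(G\cup\partial G,E)$ is; it is strongly connected if it is still connected after removing all edges joining two boundary vertices. $d(x,y)$ is the minimal number of edges in a path from $x$ to $y$ in $(G\cup\partial G,E)$ ($\infty$ if there is none). $N(\partial G)=\partial G\cup\{x\in G: x\sim z\text{ for some }z\in\partial G\}$. For $S\subseteq G$, a point $x_0\in S$ is an extreme point of $S$ if there is $z\in\partial G$ such that $x_0$ is the unique nearest point in $S$ from $z$ with respect to $d$. Two-Points Condition: every subset $S\subseteq G$ with $|S|\ge2$ has at least two extreme points. Boundary-Triangle Condition: for any $z\in\partial G$ and any distinct $x,y\in G$, if $x\sim z$ and $y\sim z$ then $x\sim y$. For $u:G\cup\partial G\to\mathbb R$: $(\Delta_Gu)(x)=\frac1{\mu_x}\sum_{y\sim x,\,y\in G\cup\partial G}g_{xy}(u(y)-u(x))$ for $x\in G$, and $(\partial_\nu u)(z)=\frac1{\mu_z}\sum_{x\sim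 z,\,x\in G}g_{xz}(u(x)-u(z))$ for $z\in\partial G$. $L^2(G)$ is equipped with $\langle u_1,u_2\rangle_{L^2(G)}=\sum_{x\in G}\mu_xu_1(x)u_2(x)$. Neumann boundary spectral data of $(\mathbb G,q)$: a collection $(\lambda_j,\phi_j|_{\partial G})_{j=1}^N$, $N=|G|$, with $\lambda_j\in\mathbb R$, $\phi_j:G\cup\partial G\to\mathbb R$, $(-\Delta_G+q)\phi_j=\lambda_j\phi_j$ on $G$, $\partial_\nu\phi_j|_{\partial G}=0$, and $\{\phi_j\}$ an orthonormal basis of $L^2(G)$. A boundary-isomorphism is a bijection $\Phi_0:N(\partial G)\to N(\partial G')$ such that $\Phi_0|_{\partial G}:\partial G\to\partial G'$ is bijective and, for all $z\in\partial G$, $y\in N(\partial G)$: $y\sim z$ iff $\Phi_0(y)\sim'\Phi_0(z)$. $(\mathbb G,q)$ is spectrally isomorphic to $(\mathbb G',q')$ with boundary-isomorphism $\Phi_0$ if $\Phi_0$ is a boundary-isomorphism, the two Neumann boundary spectral data have the same number of eigenvalues counting multiplicities, and there is a choice of Neumann boundary spectral data of both such that $\lambda_j=\lambda_j'$ and $\phi_j|_{\partial G}=\phi_j'\circ\Phi_0|_{\partial G}$ for all $j$. *)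

theory Defs
  imports Complex_Main "HOL-Library.Extended_Nat"
begin

record 'v bgraph =
  inner_verts :: "'v set"
  bdry_verts :: "'v set"
  edges :: "'v set set"
  vweight :: "'v \<Rightarrow> real"
  eweight :: "'v set \<Rightarrow> real"

definition verts :: "('v, 'm) bgraph_scheme \<Rightarrow> 'v set" where
  "verts G = inner_verts G \<union> bdry_verts G"

text \<open>Weights and functions on vertices or edges are total functions of the ambient type;
  only their values on the vertices and edges of the graph are ever used.\<close>

locale weighted_bgraph =
  fixes G :: "('v, 'm) bgraph_scheme"
  assumes disjoint_verts: "inner_verts G \<inter> bdry_verts G = {}"
    and edge_subset: "e \<in> edges G \<Longrightarrow> e \<subseteq> verts G"
    and edge_card: "e \<in> edges G \<Longrightarrow> card e = 2"
    and vweight_pos: "x \<in> verts G \<Longrightarrow> 0 < vweight G x"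
    and eweight_pos: "e \<in> edges G \<Longrightarrow> 0 < eweight G e"

locale finite_weighted_bgraph = weighted_bgraph +
  assumes finite_verts: "finite (verts G)"

definition adj :: "('v, 'm) bgraph_scheme \<Rightarrow> 'v \<Rightarrow> 'v \<Rightarrow> bool" where
  "adj G x y \<longleftrightarrow> {x, y} \<in> edges G"

definition deg :: "('v, 'm) bgraph_scheme \<Rightarrow> 'v \<Rightarrow> nat" where
  "deg G x = card {y \<in> verts G. adj G x y}"

definition connected_bgraph :: "('v, 'm) bgraph_scheme \<Rightarrow> bool" where
  "connected_bgraph G \<longleftrightarrow> (\<forall>x\<in>verts G. \<forall>y\<in>verts G. (adj G)\<^sup>*\<^sup>* x y)"

definition strongly_connected_bgraph :: "('v, 'm) bgraph_scheme \<Rightarrow> bool" where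
  "strongly_connected_bgraph G \<longleftrightarrow>
     connected_bgraph (G\<lparr>edges := {e \<in> edges G. \<not> e \<subseteq> bdry_verts G}\<rparr>)"

text \<open>\<open>(adj G ^^ n) x y\<close> says that there is a path with \<open>n\<close> edges from \<open>x\<close> to \<open>y\<close>
  (repeated vertices do not affect the minimum);
  the infimum of the empty set in \<open>enat\<close> is \<open>\<infinity>\<close>.\<close>

definition gdist :: "('v, 'm) bgraph_scheme \<Rightarrow> 'v \<Rightarrow> 'v \<Rightarrow> enat" where
  "gdist G x y = (INF n\<in>{n. (adj G ^^ n) x y}. enat n)"

definition bdry_nbhd :: "('v, 'm) bgraph_scheme \<Rightarrow> 'v set" where
  "bdry_nbhd G = bdry_verts G \<union> {x \<in> inner_verts G. \<exists>z\<in>bdry_verts G. adj G x z}"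

definition nearest_points :: "('v, 'm) bgraph_scheme \<Rightarrow> 'v set \<Rightarrow> 'v \<Rightarrow> 'v set" where
  "nearest_points G S z = {x \<in> S. \<forall>y\<in>S. gdist G x z \<le> gdist G y z}"

definition extreme_point :: "('v, 'm) bgraph_scheme \<Rightarrow> 'v set \<Rightarrow> 'v \<Rightarrow> bool" where
  "extreme_point G S x \<longleftrightarrow> x \<in> S \<and> (\<exists>z\<in>bdry_verts G. nearest_points G S z = {x})"

definition two_points_condition :: "('v, 'm) bgraph_scheme \<Rightarrow> bool" where
  "two_points_condition G \<longleftrightarrow>
     (\<forall>S\<subseteq>inner_verts G. (\<exists>x\<in>S. \<exists>y\<in>S. x \<noteq> y) \<longrightarrow>
        (\<exists>x y. x \<noteq> y \<and> extreme_point G S x \<and> extreme_point G S y))"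

definition boundary_triangle_condition :: "('v, 'm) bgraph_scheme \<Rightarrow> bool" where
  "boundary_triangle_condition G \<longleftrightarrow>
     (\<forall>z\<in>bdry_verts G. \<forall>x\<in>inner_verts G. \<forall>y\<in>inner_verts G.
        x \<noteq> y \<and> adj G x z \<and> adj G y z \<longrightarrow> adj G x y)"

definition laplacian :: "('v, 'm) bgraph_scheme \<Rightarrow> ('v \<Rightarrow> real) \<Rightarrow> 'v \<Rightarrow> real" where
  "laplacian G u x =
     1 / vweight G x * (\<Sum>y\<in>{y \<in> verts G. adj G x y}. eweight G {x, y} * (u y - u x))"

definition normal_deriv :: "('v, 'm) bgraph_scheme \<Rightarrow> ('v \<Rightarrow> real) \<Rightarrow> 'v \<Rightarrow> real" where
  "normal_deriv G u z =
     1 / vweight G z * (\<Sum>x\<in>{x \<in> inner_verts G. adj G x z}. eweight G {x, z} * (u x - u z))"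

definition L2_inner :: "('v, 'm) bgraph_scheme \<Rightarrow> ('v \<Rightarrow> real) \<Rightarrow> ('v \<Rightarrow> real) \<Rightarrow> real" where
  "L2_inner G u v = (\<Sum>x\<in>inner_verts G. vweight G x * u x * v x)"

definition L2_orthonormal_basis ::
    "('v, 'm) bgraph_scheme \<Rightarrow> nat \<Rightarrow> (nat \<Rightarrow> 'v \<Rightarrow> real) \<Rightarrow> bool" where
  "L2_orthonormal_basis G N \<phi> \<longleftrightarrow>
     (\<forall>i\<in>{1..N}. \<forall>j\<in>{1..N}. L2_inner G (\<phi> i) (\<phi> j) = (if i = j then 1 else 0)) \<and>
     (\<forall>u. \<exists>c. \<forall>x\<in>inner_verts G. u x = (\<Sum>j=1..N. c j * \<phi> j x))"

text \<open>The boundary spectral data proper are the eigenvalues \<open>\<kappa> j\<close> together with the restrictions of the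
  \<open>\<phi> j\<close> to the boundary; the predicate below keeps the full eigenfunctions, and the
  restriction is taken where two sets of data are compared.\<close>

definition neumann_spectral_data ::
    "('v, 'm) bgraph_scheme \<Rightarrow> ('v \<Rightarrow> real) \<Rightarrow> nat \<Rightarrow> (nat \<Rightarrow> real) \<Rightarrow> (nat \<Rightarrow> 'v \<Rightarrow> real) \<Rightarrow> bool"
  where
  "neumann_spectral_data G q N \<kappa> \<phi> \<longleftrightarrow>
     N = card (inner_verts G) \<and>
     (\<forall>j\<in>{1..N}.
        (\<forall>x\<in>inner_verts G. - laplacian G (\<phi> j) x + q x * \<phi> j x = \<kappa> j * \<phi> j x) \<and>
        (\<forall>z\<in>bdry_verts G. normal_deriv G (\<phi> j) z = 0)) \<and>
     L2_orthonormal_basis G N \<phi>"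

definition boundary_isomorphism ::
    "('v, 'm) bgraph_scheme \<Rightarrow> ('w, 'n) bgraph_scheme \<Rightarrow> ('v \<Rightarrow> 'w) \<Rightarrow> bool" where
  "boundary_isomorphism G G' \<Phi>\<^sub>0 \<longleftrightarrow>
     bij_betw \<Phi>\<^sub>0 (bdry_nbhd G) (bdry_nbhd G') \<and>
     bij_betw \<Phi>\<^sub>0 (bdry_verts G) (bdry_verts G') \<and>
     (\<forall>z\<in>bdry_verts G. \<forall>y\<in>bdry_nbhd G. adj G y z \<longleftrightarrow> adj G' (\<Phi>\<^sub>0 y) (\<Phi>\<^sub>0 z))"

text \<open>The common \<open>N\<close> expresses that both data have the same number of eigenvalues,
  counted with multiplicity.\<close>

definition spectrally_isomorphic ::
    "('v, 'm) bgraph_scheme \<Rightarrow> ('v \<Rightarrow> real) \<Rightarrow>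
     ('w, 'n) bgraph_scheme \<Rightarrow> ('w \<Rightarrow> real) \<Rightarrow> ('v \<Rightarrow> 'w) \<Rightarrow> bool" where
  "spectrally_isomorphic G q G' q' \<Phi>\<^sub>0 \<longleftrightarrow>
     boundary_isomorphism G G' \<Phi>\<^sub>0 \<and>
     (\<exists>N \<kappa> \<phi> \<kappa>' \<phi>'.
        neumann_spectral_data G q N \<kappa> \<phi> \<and>
        neumann_spectral_data G' q' N \<kappa>' \<phi>' \<and>
        (\<forall>j\<in>{1..N}. \<kappa> j = \<kappa>' j \<and> (\<forall>z\<in>bdry_verts G. \<phi> j z = \<phi>' j (\<Phi>\<^sub>0 z))))"

definition vweights_agree ::
    "('v, 'm) bgraph_scheme \<Rightarrow> ('w, 'n) bgraph_scheme \<Rightarrow> ('v \<Rightarrow> 'w) \<Rightarrow> bool" where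
  "vweights_agree G G' \<Phi> \<longleftrightarrow> (\<forall>x\<in>verts G. vweight G x = vweight G' (\<Phi> x))"

definition inner_eweights_agree ::
    "('v, 'm) bgraph_scheme \<Rightarrow> ('w, 'n) bgraph_scheme \<Rightarrow> ('v \<Rightarrow> 'w) \<Rightarrow> bool" where
  "inner_eweights_agree G G' \<Phi> \<longleftrightarrow>
     (\<forall>x\<in>verts G. \<forall>y\<in>verts G. adj G x y \<and> (x \<in> inner_verts G \<or> y \<in> inner_verts G) \<longrightarrow>
        eweight G {x, y} = eweight G' {\<Phi> x, \<Phi> y})"

definition potentials_agree ::
    "('v, 'm) bgraph_scheme \<Rightarrow> ('v \<Rightarrow> 'w) \<Rightarrow> ('v \<Rightarrow> real) \<Rightarrow> ('w \<Rightarrow> real) \<Rightarrow> bool" where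
  "potentials_agree G \<Phi> q q' \<longleftrightarrow> (\<forall>x\<in>inner_verts G. q x = q' (\<Phi> x))"

end

theory Submission
  imports Defs
begin

text \<open>
  Since the \<open>\<phi> j\<close> satisfy the Neumann condition, their boundary values are weighted means of interior
  values, so \<open>- \<Delta> + q\<close> becomes a self-adjoint operator \<open>H\<close> on \<open>L\<^sup>2\<close> of the interior with a symmetric
  kernel (\<open>neumann_kernel\<close>). By the Boundary-Triangle Condition, eliminating the boundary creates
  no coupling between non-adjacent vertices: the off-diagonal entries of the kernel are negative on
  edges and zero elsewhere. Moreover the change in the entries depends only on the weights of
  the edges at the boundary, which are the same for both graphs.

  For a boundary vertex \<open>z\<close>, evaluation at \<open>z\<close> is, up to a constant factor, the inner product with a
  function \<open>b\<close> living on the neighbours of \<open>z\<close>. The iterates \<open>(H ^ t) b\<close> (\<open>boundary_wave\<close>) form a wave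
  with finite speed: at time \<open>t\<close> it has reached at most distance \<open>t + 1\<close> from \<open>z\<close>, and at vertices of the
  front joined to \<open>z\<close> by a geodesic through the interior it has sign \<open>(-1) ^ t\<close>.
  The coefficient of this wave at \<open>\<phi> j\<close> is \<open>\<kappa> j ^ t * \<phi> j z\<close> up to the
  same constant, so it is determined by the boundary spectral data. Hence the unitary map taking
  \<open>\<phi> j\<close> to \<open>\<phi>' j\<close> intertwines the operators and carries the waves of the first graph to those of the
  second.

  The heart of the proof (\<open>transfer_offdiag\<close>) is that this unitary map sends the indicator of each \<open>x\<close>
  to a multiple of the indicator of \<open>\<Phi> x\<close>. If its image had another vertex in its support,
  the Two-Points Condition for the support together with \<open>\<Phi> x\<close> would give an extreme point \<open>y\<close>
  different from \<open>\<Phi> x\<close>. Some wave would detect \<open>y\<close>, and no other vertex of the support, before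
  it could reach \<open>\<Phi> x\<close>; but the corresponding wave in the first graph cannot have reached \<open>x\<close>
  by then. Positivity on the front fixes the sign of the multiple, and unitarity its modulus, the square
  root of \<open>vweight G x / vweight G' (\<Phi> x)\<close>.

  The unitary map is thus a positive diagonal matrix that intertwines the kernels. If the vertex weights agree,
  it is the identity, the kernels coincide and edge weights and potential can be read off. If both potentials
  vanish, constants are annihilated by both operators, so the diagonal is itself a harmonic function; it equals \<open>1\<close> next
  to the boundary, where it is seen by the waves at time \<open>0\<close>, and so it is \<open>1\<close> everywhere by the
  maximum principle.
\<close>

section \<open>Eliminating the boundary values\<close>

definition conductance :: "('v, 'm) bgraph_scheme \<Rightarrow> 'v \<Rightarrow> 'v \<Rightarrow> real" where
  "conductance G x y = (if adj G x y then eweight G {x, y} else 0)"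

definition inner_conductance :: "('v, 'm) bgraph_scheme \<Rightarrow> 'v \<Rightarrow> real" where
  "inner_conductance G z = (\<Sum>x\<in>inner_verts G. conductance G x z)"

text \<open>The matrix of \<open>- \<Delta> + q\<close> after substituting for every boundary value the weighted mean forced by
  the Neumann condition (a Schur complement). It is not divided by the vertex weight of \<open>x\<close>,
  which makes it symmetric in \<open>x\<close> and \<open>y\<close>.\<close>

definition neumann_kernel :: "('v, 'm) bgraph_scheme \<Rightarrow> ('v \<Rightarrow> real) \<Rightarrow> 'v \<Rightarrow> 'v \<Rightarrow> real" where
  "neumann_kernel G q x y =
     (if x = y then (\<Sum>v\<in>verts G. conductance G x v) + vweight G x * q x else 0)
     - conductance G x y
     - (\<Sum>z\<in>bdry_verts G. conductance G x z * conductance G y z / inner_conductance G z)"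

lemma adj_commute: "adj G x y \<longleftrightarrow> adj G y x"
  by (simp add: adj_def insert_commute)

lemma conductance_commute: "conductance G x y = conductance G y x"
  by (simp add: conductance_def adj_commute[of G x y] insert_commute)

lemma neumann_kernel_commute: "neumann_kernel G q x y = neumann_kernel G q y x"
  by (simp add: neumann_kernel_def conductance_commute[of G x y] mult.commute)

context finite_weighted_bgraph
begin

lemma finite_inner: "finite (inner_verts G)" and finite_bdry: "finite (bdry_verts G)"
  using finite_verts by (auto simp: verts_def)

lemma adj_verts: "adj G x y \<Longrightarrow> x \<in> verts G \<and> y \<in> verts G"
  using edge_subset by (auto simp: adj_def)

lemma adj_irrefl: "\<not> adj G x x"
  using edge_card[of "{x}"] by (auto simp: adj_def)

lemma conductance_nonneg: "0 \<le> conductance G x y"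
  using eweight_pos by (auto simp: conductance_def adj_def less_imp_le)

lemma conductance_pos: "adj G x y \<Longrightarrow> 0 < conductance G x y"
  using eweight_pos by (auto simp: conductance_def adj_def)

lemma inner_vweight_nonzero: "x \<in> inner_verts G \<Longrightarrow> vweight G x \<noteq> 0"
  using vweight_pos[of x] by (simp add: verts_def)

lemma inner_conductance_nonneg: "0 \<le> inner_conductance G z"
  by (simp add: inner_conductance_def sum_nonneg conductance_nonneg)

lemma inner_conductance_pos:
  assumes "x \<in> inner_verts G" "adj G x z"
  shows "0 < inner_conductance G z"
  unfolding inner_conductance_def
  using assms finite_inner conductance_pos conductance_nonneg by (intro sum_pos2[of _ x]) auto

lemma conductance_eq_0_if_inner_conductance_0:
  assumes "x \<in> inner_verts G" "inner_conductance G z = 0"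
  shows "conductance G x z = 0"
  using inner_conductance_pos[of x z] assms by (auto simp: conductance_def)

lemma sum_verts: "(\<Sum>v\<in>verts G. h v) = (\<Sum>x\<in>inner_verts G. h x) + (\<Sum>z\<in>bdry_verts G. h z)"
  unfolding verts_def using finite_inner finite_bdry disjoint_verts by (rule sum.union_disjoint)

lemma laplacian_conductance:
  "laplacian G u x = 1 / vweight G x * (\<Sum>v\<in>verts G. conductance G x v * (u v - u x))"
proof -
  have "(\<Sum>y\<in>{y \<in> verts G. adj G x y}. eweight G {x, y} * (u y - u x))
      = (\<Sum>v\<in>verts G. if adj G x v then eweight G {x, v} * (u v - u x) else 0)"
    using finite_verts by (simp add: sum.inter_filter)
  also have "\<dots> = (\<Sum>v\<in>verts G. conductance G x v * (u v - u x))"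
    by (rule sum.cong) (auto simp: conductance_def)
  finally show ?thesis by (simp add: laplacian_def)
qed

lemma normal_deriv_zero_imp_mean:
  assumes "z \<in> bdry_verts G" "normal_deriv G u z = 0"
  shows "(\<Sum>x\<in>inner_verts G. conductance G x z * u x) = inner_conductance G z * u z"
proof -
  have "vweight G z > 0" using assms vweight_pos by (auto simp: verts_def)
  then have "0 = (\<Sum>x\<in>{x \<in> inner_verts G. adj G x z}. eweight G {x, z} * (u x - u z))"
    using assms(2) by (simp add: normal_deriv_def)
  also have "\<dots> = (\<Sum>x\<in>inner_verts G. if adj G x z then eweight G {x, z} * (u x - u z) else 0)"
    using finite_inner by (simp add: sum.inter_filter)
  also have "\<dots> = (\<Sum>x\<in>inner_verts G. conductance G x z * u x - conductance G x z * u z)"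
    by (rule sum.cong) (auto simp: conductance_def algebra_simps)
  also have "\<dots> = (\<Sum>x\<in>inner_verts G. conductance G x z * u x) - inner_conductance G z * u z"
    by (simp add: sum_subtractf inner_conductance_def sum_distrib_right)
  finally show ?thesis by simp
qed

text \<open>The purpose of the kernel. Besides eigenfunctions, the lemma applies to constants and to the
  ratio of normalisations that appears when the potentials vanish.\<close>

lemma neumann_kernel_apply:
  assumes x: "x \<in> inner_verts G"
    and mean: "\<And>z. z \<in> bdry_verts G \<Longrightarrow>
      (\<Sum>y\<in>inner_verts G. conductance G y z * u y) = inner_conductance G z * u z"
  shows "(\<Sum>y\<in>inner_verts G. neumann_kernel G q x y * u y)
    = vweight G x * q x * u x - (\<Sum>v\<in>verts G. conductance G x v * (u v - u x))"
proof -
  let ?c = "conductance G" and ?D = "inner_conductance G"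
  have elim: "(\<Sum>y\<in>inner_verts G. (\<Sum>z\<in>bdry_verts G. ?c x z * ?c y z / ?D z) * u y)
      = (\<Sum>z\<in>bdry_verts G. ?c x z * u z)"
  proof -
    have "(\<Sum>y\<in>inner_verts G. (\<Sum>z\<in>bdry_verts G. ?c x z * ?c y z / ?D z) * u y)
        = (\<Sum>y\<in>inner_verts G. \<Sum>z\<in>bdry_verts G. ?c x z / ?D z * (?c y z * u y))"
      by (simp add: sum_distrib_left sum_distrib_right mult_ac)
    also have "\<dots> = (\<Sum>z\<in>bdry_verts G. ?c x z / ?D z * (\<Sum>y\<in>inner_verts G. ?c y z * u y))"
      by (subst sum.swap) (simp add: sum_distrib_left)
    also have "\<dots> = (\<Sum>z\<in>bdry_verts G. ?c x z * u z)"
      using mean conductance_eq_0_if_inner_conductance_0[OF x] by (intro sum.cong) auto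
    finally show ?thesis .
  qed
  have diag: "(\<Sum>y\<in>inner_verts G. (if x = y then A else 0) * u y) = A * u x" for A :: real
  proof -
    have "(\<Sum>y\<in>inner_verts G. (if x = y then A else 0) * u y)
        = (\<Sum>y\<in>inner_verts G. if x = y then A * u y else 0)"
      by (rule sum.cong) auto
    then show ?thesis using x finite_inner by (simp add: sum.delta')
  qed
  have "(\<Sum>y\<in>inner_verts G. neumann_kernel G q x y * u y)
      = ((\<Sum>v\<in>verts G. ?c x v) + vweight G x * q x) * u x
        - (\<Sum>y\<in>inner_verts G. ?c x y * u y) - (\<Sum>z\<in>bdry_verts G. ?c x z * u z)"
    by (simp only: neumann_kernel_def left_diff_distrib sum_subtractf diag elim)
  also have "\<dots> = vweight G x * q x * u x - (\<Sum>v\<in>verts G. ?c x v * (u v - u x))"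
    using sum_verts[of "\<lambda>v. ?c x v * u v"]
    by (simp add: right_diff_distrib sum_subtractf sum_distrib_right distrib_right)
  finally show ?thesis .
qed

lemma neumann_kernel_eigenfunction:
  assumes x: "x \<in> inner_verts G"
    and eigen: "- laplacian G u x + q x * u x = \<kappa> * u x"
    and neumann: "\<forall>z\<in>bdry_verts G. normal_deriv G u z = 0"
  shows "(\<Sum>y\<in>inner_verts G. neumann_kernel G q x y * u y) = \<kappa> * vweight G x * u x"
proof -
  let ?L = "\<Sum>v\<in>verts G. conductance G x v * (u v - u x)"
  have pos: "vweight G x > 0" using x vweight_pos by (auto simp: verts_def)
  have "(\<Sum>y\<in>inner_verts G. neumann_kernel G q x y * u y) = vweight G x * q x * u x - ?L"
    using neumann_kernel_apply[OF x] normal_deriv_zero_imp_mean neumann by blast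
  also have "\<dots> = vweight G x * (- laplacian G u x + q x * u x)"
    using pos by (simp add: laplacian_conductance field_simps)
  also have "\<dots> = \<kappa> * vweight G x * u x" unfolding eigen by simp
  finally show ?thesis .
qed

lemma neumann_kernel_offdiag_nonpos:
  assumes "x \<noteq> y"
  shows "neumann_kernel G q x y \<le> - conductance G x y"
proof -
  have "0 \<le> (\<Sum>z\<in>bdry_verts G. conductance G x z * conductance G y z / inner_conductance G z)"
    using conductance_nonneg inner_conductance_nonneg by (intro sum_nonneg) simp
  then show ?thesis using assms by (simp add: neumann_kernel_def)
qed

text \<open>This is where the Boundary-Triangle Condition enters: two interior vertices that are coupled through
  a boundary vertex are already adjacent.\<close>

lemma neumann_kernel_local:
  assumes bt: "boundary_triangle_condition G"
    and xy: "x \<in> inner_verts G" "y \<in> inner_verts G" "x \<noteq> y" "\<not> adj G x y"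
  shows "neumann_kernel G q x y = 0"
proof -
  have "conductance G x z * conductance G y z = 0" if "z \<in> bdry_verts G" for z
    using bt xy that unfolding boundary_triangle_condition_def conductance_def by auto
  then have "(\<Sum>z\<in>bdry_verts G. conductance G x z * conductance G y z / inner_conductance G z) = 0"
    by (intro sum.neutral) auto
  then show ?thesis using xy by (simp add: neumann_kernel_def conductance_def)
qed

end

section \<open>Waves sent from the boundary\<close>

text \<open>Powers of the operator \<open>- \<Delta> + q\<close> applied to the function that represents in \<open>L\<^sup>2\<close>, up to the factor
  \<open>inner_conductance G z\<close>, the evaluation of Neumann functions at \<open>z\<close>.\<close>

primrec boundary_wave ::
    "('v, 'm) bgraph_scheme \<Rightarrow> ('v \<Rightarrow> real) \<Rightarrow> 'v \<Rightarrow> nat \<Rightarrow> 'v \<Rightarrow> real" where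
  "boundary_wave G q z 0 = (\<lambda>x. conductance G x z / vweight G x)"
| "boundary_wave G q z (Suc t) =
     (\<lambda>x. (\<Sum>y\<in>inner_verts G. neumann_kernel G q x y * boundary_wave G q z t y) / vweight G x)"

context finite_weighted_bgraph
begin

text \<open>By symmetry of the kernel the powers of the operator can be moved to the eigenfunction, and at
  time \<open>0\<close> the Neumann condition turns the inner product into a boundary value.\<close>

lemma boundary_wave_coefficient:
  assumes eigen: "\<forall>x\<in>inner_verts G. - laplacian G u x + q x * u x = \<kappa> * u x"
    and neumann: "\<forall>z\<in>bdry_verts G. normal_deriv G u z = 0"
    and z: "z \<in> bdry_verts G"
  shows "L2_inner G (boundary_wave G q z t) u = \<kappa> ^ t * inner_conductance G z * u z"
proof (induction t)
  case 0
  have "L2_inner G (boundary_wave G q z 0) u = (\<Sum>x\<in>inner_verts G. conductance G x z * u x)"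
    unfolding L2_inner_def by (intro sum.cong) (simp_all add: inner_vweight_nonzero)
  then show ?case using normal_deriv_zero_imp_mean[OF z] neumann z by simp
next
  case (Suc t)
  let ?f = "boundary_wave G q z t"
  have "L2_inner G (boundary_wave G q z (Suc t)) u
      = (\<Sum>x\<in>inner_verts G. \<Sum>y\<in>inner_verts G. neumann_kernel G q x y * ?f y * u x)"
    unfolding L2_inner_def
    by (intro sum.cong) (simp_all add: inner_vweight_nonzero sum_distrib_right)
  also have "\<dots> = (\<Sum>y\<in>inner_verts G. ?f y * (\<Sum>x\<in>inner_verts G. neumann_kernel G q y x * u x))"
    by (subst sum.swap)
      (auto simp: sum_distrib_left neumann_kernel_commute mult_ac intro!: sum.cong)
  also have "\<dots> = (\<Sum>y\<in>inner_verts G. ?f y * (\<kappa> * vweight G y * u y))"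
    using neumann_kernel_eigenfunction eigen neumann by (intro sum.cong) auto
  also have "\<dots> = \<kappa> * L2_inner G ?f u"
    by (simp add: L2_inner_def sum_distrib_left mult_ac)
  finally show ?case by (simp add: Suc.IH)
qed

lemma boundary_wave_finite_speed:
  assumes bt: "boundary_triangle_condition G"
  shows "x \<in> inner_verts G \<Longrightarrow> boundary_wave G q z t x \<noteq> 0 \<Longrightarrow> \<exists>s\<le>Suc t. (adj G ^^ s) x z"
proof (induction t arbitrary: x)
  case 0
  then have "adj G x z" by (auto simp: conductance_def split: if_splits)
  then show ?case by (intro exI[of _ 1]) auto
next
  case (Suc t)
  from Suc.prems have "(\<Sum>y\<in>inner_verts G. neumann_kernel G q x y * boundary_wave G q z t y) \<noteq> 0"
    by auto
  then obtain y where y: "y \<in> inner_verts G" "neumann_kernel G q x y \<noteq> 0"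
      "boundary_wave G q z t y \<noteq> 0"
    by (metis (no_types, lifting) mult_eq_0_iff sum.neutral)
  from Suc.IH[OF y(1,3)] obtain s where s: "s \<le> Suc t" "(adj G ^^ s) y z" by blast
  show ?case
  proof (cases "x = y")
    case True
    then show ?thesis using s by (intro exI[of _ s]) auto
  next
    case False
    then have "adj G x y" using neumann_kernel_local[OF bt] Suc.prems(1) y by blast
    then have "(adj G ^^ Suc s) x z" using s(2) by (rule relpowp_Suc_I2)
    then show ?thesis using s(1) by (intro exI[of _ "Suc s"]) auto
  qed
qed

text \<open>Ahead of the front the wave vanishes, so on the front the diagonal of the kernel contributes nothing,
  and each step contributes one factor of the sign of the off-diagonal entries.\<close>

lemma boundary_wave_front_step:
  assumes bt: "boundary_triangle_condition G"
    and x: "x \<in> inner_verts G" and front: "\<forall>s\<le>Suc t. \<not> (adj G ^^ s) x z"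
    and nonneg: "\<And>y. y \<in> inner_verts G \<Longrightarrow> \<forall>s\<le>t. \<not> (adj G ^^ s) y z \<Longrightarrow>
      0 \<le> (-1) ^ t * boundary_wave G q z t y"
    and y: "y \<in> inner_verts G"
  shows "0 \<le> - neumann_kernel G q x y * ((-1) ^ t * boundary_wave G q z t y)"
proof (cases "x = y")
  case True
  then have "boundary_wave G q z t y = 0"
    using boundary_wave_finite_speed[OF bt x, of q z t] front by blast
  then show ?thesis by simp
next
  case False
  show ?thesis
  proof (cases "adj G x y")
    case True
    have "\<forall>s\<le>t. \<not> (adj G ^^ s) y z"
      using front relpowp_Suc_I2[of "adj G" x y _ z] True by (meson Suc_le_mono)
    then have "0 \<le> (-1) ^ t * boundary_wave G q z t y" using nonneg y by blast
    moreover have "0 \<le> - neumann_kernel G q x y"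
      using neumann_kernel_offdiag_nonpos[OF False, of q] conductance_nonneg[of x y] by linarith
    ultimately show ?thesis by (metis mult_nonneg_nonneg)
  next
    case False
    then show ?thesis using neumann_kernel_local[OF bt x y \<open>x \<noteq> y\<close>] by simp
  qed
qed

lemma boundary_wave_Suc_signed:
  "(-1) ^ Suc t * boundary_wave G q z (Suc t) x
    = (\<Sum>y\<in>inner_verts G. - neumann_kernel G q x y * ((-1) ^ t * boundary_wave G q z t y))
      / vweight G x"
  by (simp add: sum_distrib_left sum_negf mult_ac)

lemma boundary_wave_front_nonneg:
  assumes bt: "boundary_triangle_condition G"
  shows "x \<in> inner_verts G \<Longrightarrow> \<forall>s\<le>t. \<not> (adj G ^^ s) x z \<Longrightarrow>
    0 \<le> (-1) ^ t * boundary_wave G q z t x"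
proof (induction t arbitrary: x)
  case 0
  then show ?case using conductance_nonneg vweight_pos[of x] by (simp add: verts_def)
next
  case (Suc t)
  have "0 \<le> vweight G x" using vweight_pos[of x] Suc.prems by (simp add: verts_def)
  then show ?case
    unfolding boundary_wave_Suc_signed
    using boundary_wave_front_step[OF bt Suc.prems] Suc.IH
    by (intro divide_nonneg_nonneg sum_nonneg) blast+
qed

definition inner_adj :: "'a \<Rightarrow> 'a \<Rightarrow> bool" where
  "inner_adj x y \<longleftrightarrow> adj G x y \<and> x \<in> inner_verts G \<and> y \<in> inner_verts G"

lemma boundary_wave_front_pos:
  assumes bt: "boundary_triangle_condition G"
  shows "x \<in> inner_verts G \<Longrightarrow> \<forall>s\<le>t. \<not> (adj G ^^ s) x z \<Longrightarrow>
    (inner_adj ^^ t) x v \<Longrightarrow> adj G v z \<Longrightarrow> 0 < (-1) ^ t * boundary_wave G q z t x"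
proof (induction t arbitrary: x)
  case 0
  then show ?case using conductance_pos vweight_pos[of x] by (simp add: verts_def)
next
  case (Suc t)
  from Suc.prems(3) obtain y where y: "inner_adj x y" "(inner_adj ^^ t) y v"
    by (meson relpowp_Suc_D2)
  have xy: "x \<noteq> y" "adj G x y" "y \<in> inner_verts G"
    using y(1) adj_irrefl by (auto simp: inner_adj_def)
  have "\<forall>s\<le>t. \<not> (adj G ^^ s) y z"
    using Suc.prems(2) relpowp_Suc_I2[of "adj G" x y _ z] xy(2) by (meson Suc_le_mono)
  then have "0 < (-1) ^ t * boundary_wave G q z t y"
    using Suc.IH[of y] xy y Suc.prems by blast
  moreover have "0 < - neumann_kernel G q x y"
    using neumann_kernel_offdiag_nonpos[OF xy(1), of q] conductance_pos[OF xy(2)] by linarith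
  ultimately have "0 < - neumann_kernel G q x y * ((-1) ^ t * boundary_wave G q z t y)"
    by (metis mult_pos_pos)
  then have "0 < (\<Sum>y\<in>inner_verts G.
      - neumann_kernel G q x y * ((-1) ^ t * boundary_wave G q z t y))"
    using boundary_wave_front_step[OF bt Suc.prems(1,2)] boundary_wave_front_nonneg[OF bt]
      finite_inner xy(3) by (intro sum_pos2[of _ y]) blast+
  moreover have "0 < vweight G x" using vweight_pos[of x] Suc.prems by (simp add: verts_def)
  ultimately show ?case unfolding boundary_wave_Suc_signed by (rule divide_pos_pos)
qed

text \<open>Waves travel through the interior only, whereas graph distances may use edges between boundary
  vertices. The difference is harmless: if \<open>x\<close> is nearer to \<open>z\<close> than the rest of \<open>S\<close>, then the
  same holds for the first boundary vertex met by a geodesic from \<open>x\<close> to \<open>z\<close>,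
  and up to that vertex the geodesic is interior.\<close>

lemma separating_wave:
  assumes bt: "boundary_triangle_condition G"
    and x: "x \<in> inner_verts G" and z: "z \<in> bdry_verts G"
    and path: "(adj G ^^ n) x z"
    and far: "\<forall>y\<in>S - {x}. \<forall>s\<le>n. \<not> (adj G ^^ s) y z"
  obtains z' t where "z' \<in> bdry_verts G" "0 < (-1) ^ t * boundary_wave G q z' t x"
    "\<forall>s\<le>t. \<not> (adj G ^^ s) x z'" "\<forall>y\<in>S - {x}. \<forall>s\<le>Suc t. \<not> (adj G ^^ s) y z'"
proof -
  \<comment> \<open>A boundary vertex on the way from \<open>x\<close> to \<open>z\<close> also separates \<open>x\<close> from \<open>S\<close>; so a separating path of
    least length meets the boundary only at its end.\<close>
  define P where "P n \<longleftrightarrow> (\<exists>z\<in>bdry_verts G. (adj G ^^ n) x z \<and>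
    (\<forall>y\<in>S - {x}. \<forall>s\<le>n. \<not> (adj G ^^ s) y z))" for n
  define m where "m = (LEAST n. P n)"
  have "P n" using z path far by (auto simp: P_def)
  then have "P m" unfolding m_def by (rule LeastI)
  then obtain z' where z': "z' \<in> bdry_verts G" "(adj G ^^ m) x z'"
      "\<forall>y\<in>S - {x}. \<forall>s\<le>m. \<not> (adj G ^^ s) y z'"
    by (auto simp: P_def)
  have min: "\<not> P i" if "i < m" for i using that not_less_Least unfolding m_def by blast
  have "m \<noteq> 0"
    using z' x disjoint_verts by (metis disjoint_iff relpowp_0_E)
  then obtain t where t: "m = Suc t" using not0_implies_Suc by blast
  have interior: "i \<le> t \<Longrightarrow> \<exists>v\<in>inner_verts G. (inner_adj ^^ i) x v \<and> (adj G ^^ i) x v \<and>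
      (adj G ^^ (m - i)) v z'" for i
  proof (induction i)
    case 0
    show ?case using x z' by (intro bexI[of _ x]) auto
  next
    case (Suc i)
    then obtain v where v: "v \<in> inner_verts G" "(inner_adj ^^ i) x v" "(adj G ^^ i) x v"
        "(adj G ^^ (m - i)) v z'"
      by auto
    have "m - i = Suc (m - Suc i)" using Suc.prems t by simp
    then obtain v' where v': "adj G v v'" "(adj G ^^ (m - Suc i)) v' z'"
      using v(4) relpowp_Suc_D2 by metis
    have reach: "(adj G ^^ Suc i) x v'" using v(3) v'(1) by (rule relpowp_Suc_I)
    have "v' \<notin> bdry_verts G"
    proof
      assume b: "v' \<in> bdry_verts G"
      have "\<not> (adj G ^^ s) y v'" if y: "y \<in> S - {x}" and s: "s \<le> Suc i" for y s
      proof
        assume "(adj G ^^ s) y v'"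
        then have "(adj G ^^ (s + (m - Suc i))) y z'" using v'(2) by (rule relpowp_trans)
        moreover have "s + (m - Suc i) \<le> m" using s Suc.prems t by simp
        ultimately show False using z'(3) y by blast
      qed
      then have "P (Suc i)" using reach b by (auto simp: P_def)
      then show False using min Suc.prems t by simp
    qed
    then have "v' \<in> inner_verts G" using adj_verts[OF v'(1)] by (auto simp: verts_def)
    moreover have "(inner_adj ^^ Suc i) x v'"
      using v(2) by (rule relpowp_Suc_I) (use v v' calculation in \<open>auto simp: inner_adj_def\<close>)
    ultimately show ?case using reach v'(2) by blast
  qed
  obtain v where v: "(inner_adj ^^ t) x v" "(adj G ^^ (m - t)) v z'" using interior by blast
  then have "adj G v z'" using t by (simp add: eq_OO)
  moreover have short: "\<forall>s\<le>t. \<not> (adj G ^^ s) x z'"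
  proof (intro allI impI notI)
    fix s assume "s \<le> t" "(adj G ^^ s) x z'"
    then have "P s" using z' t by (auto simp: P_def)
    then show False using min \<open>s \<le> t\<close> t by simp
  qed
  ultimately have "0 < (-1) ^ t * boundary_wave G q z' t x"
    using boundary_wave_front_pos[OF bt x] v by blast
  then show ?thesis using that short z' t by blast
qed

lemma gdist_le_iff: "gdist G x y \<le> enat n \<longleftrightarrow> (\<exists>s\<le>n. (adj G ^^ s) x y)"
proof
  let ?A = "enat ` {n. (adj G ^^ n) x y}"
  assume le: "gdist G x y \<le> enat n"
  have gdist: "gdist G x y = Inf ?A" by (simp only: gdist_def)
  have "?A \<noteq> {}"
  proof
    assume "?A = {}"
    then have "gdist G x y = \<infinity>" by (simp only: gdist Inf_enat_def if_True refl)
    then show False using le by simp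
  qed
  then have "gdist G x y = (LEAST a. a \<in> ?A)" by (simp only: gdist Inf_enat_def if_False)
  moreover have "(LEAST a. a \<in> ?A) \<in> ?A" using \<open>?A \<noteq> {}\<close> LeastI[of "\<lambda>a. a \<in> ?A"] by blast
  ultimately have "gdist G x y \<in> ?A" by (simp only:)
  then obtain s where "gdist G x y = enat s" "(adj G ^^ s) x y" by blast
  then show "\<exists>s\<le>n. (adj G ^^ s) x y" using le by auto
next
  assume "\<exists>s\<le>n. (adj G ^^ s) x y"
  then obtain s where "s \<le> n" "(adj G ^^ s) x y" by blast
  then show "gdist G x y \<le> enat n"
    unfolding gdist_def by (intro INF_lower2[of s]) auto
qed

lemma extreme_point_path:
  assumes "extreme_point G S x" "y \<in> S" "y \<noteq> x"
  obtains z n where "z \<in> bdry_verts G" "(adj G ^^ n) x z"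
    "\<forall>y\<in>S - {x}. \<forall>s\<le>n. \<not> (adj G ^^ s) y z"
proof -
  obtain z where z: "z \<in> bdry_verts G" "nearest_points G S z = {x}"
    using assms by (auto simp: extreme_point_def)
  have less: "gdist G x z < gdist G y' z" if y': "y' \<in> S - {x}" for y'
  proof -
    have "y' \<notin> nearest_points G S z" using z(2) y' by simp
    then obtain w where w: "w \<in> S" "gdist G w z < gdist G y' z"
      using y' by (auto simp: nearest_points_def not_le)
    have "x \<in> nearest_points G S z" using z(2) by simp
    then have "gdist G x z \<le> gdist G w z" using w by (auto simp: nearest_points_def)
    then show ?thesis using w(2) by simp
  qed
  have "gdist G x z < gdist G y z" using less assms by simp
  then obtain k where k: "gdist G x z = enat k" by (cases "gdist G x z") auto
  then obtain n where n: "n \<le> k" "(adj G ^^ n) x z" using gdist_le_iff[of x z k] by auto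
  have "\<not> (adj G ^^ s) y' z" if "y' \<in> S - {x}" "s \<le> n" for y' s
  proof
    assume "(adj G ^^ s) y' z"
    then have "gdist G y' z \<le> enat k" using that n gdist_le_iff by (meson order_trans)
    then show False using less[OF that(1)] k by simp
  qed
  then show ?thesis using that z(1) n(2) by blast
qed

text \<open>The maximum principle: the set where \<open>u\<close> is maximal is closed under adjacency.\<close>

lemma harmonic_one_at_boundary_imp_one:
  assumes conn: "connected_bgraph G" and ne: "bdry_verts G \<noteq> {}"
    and nbhd: "\<And>x. x \<in> bdry_nbhd G \<Longrightarrow> u x = 1"
    and harm: "\<And>x. x \<in> inner_verts G \<Longrightarrow>
      (\<Sum>v\<in>verts G. conductance G x v * (u v - u x)) = 0"
    and x: "x \<in> verts G"
  shows "u x = 1"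
proof -
  define M where "M = Max (u ` verts G)"
  have le: "u v \<le> M" if "v \<in> verts G" for v
    using that finite_verts by (simp add: M_def)
  have "M \<in> u ` verts G" unfolding M_def using x finite_verts by (intro Max_in) auto
  then obtain x0 where x0: "x0 \<in> verts G" "u x0 = M" by blast
  have step: "u y = M" if "adj G v y" "u v = M" for v y
  proof (cases "v \<in> inner_verts G")
    case True
    have "(\<Sum>w\<in>verts G. conductance G v w * (M - u w)) = 0"
      using harm[OF True] that(2) by (simp add: right_diff_distrib sum_subtractf)
    moreover have "0 \<le> conductance G v w * (M - u w)" if "w \<in> verts G" for w
      using le[OF that] conductance_nonneg by simp
    ultimately have "conductance G v y * (M - u y) = 0"
      using sum_nonneg_0[OF finite_verts, of "\<lambda>w. conductance G v w * (M - u w)" y]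
        adj_verts[OF that(1)] by simp
    then show ?thesis using conductance_pos[OF that(1)] by simp
  next
    case False
    then have "v \<in> bdry_verts G" using adj_verts[OF that(1)] by (simp add: verts_def)
    moreover have "y \<in> bdry_nbhd G"
      using calculation adj_verts[OF that(1)] that(1) adj_commute[of G v y]
      by (auto simp: bdry_nbhd_def verts_def)
    ultimately show ?thesis using nbhd[of v] nbhd[of y] that(2) by (simp add: bdry_nbhd_def)
  qed
  have const: "u y = M" if "y \<in> verts G" for y
  proof -
    have "(adj G)\<^sup>*\<^sup>* x0 y" using conn that x0 by (auto simp: connected_bgraph_def)
    then show ?thesis by (induction rule: rtranclp_induct) (use x0(2) step in blast)+
  qed
  obtain z where "z \<in> bdry_verts G" using ne by blast
  then have "u z = 1" "z \<in> verts G" using nbhd by (auto simp: bdry_nbhd_def verts_def)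
  then show ?thesis using const x by metis
qed

end

lemma strongly_connected_imp_connected:
  assumes "strongly_connected_bgraph G"
  shows "connected_bgraph G"
proof -
  let ?H = "G\<lparr>edges := {e \<in> edges G. \<not> e \<subseteq> bdry_verts G}\<rparr>"
  have "adj ?H \<le> adj G" by (auto simp: adj_def)
  then have "(adj ?H)\<^sup>*\<^sup>* \<le> (adj G)\<^sup>*\<^sup>*" by (rule rtranclp_mono)
  moreover have "verts ?H = verts G" by (simp add: verts_def)
  ultimately show ?thesis
    using assms by (auto simp: strongly_connected_bgraph_def connected_bgraph_def)
qed

section \<open>Orthonormal bases of the interior\<close>

context finite_weighted_bgraph
begin

lemma L2_inner_sum_left:
  assumes "\<forall>x\<in>inner_verts G. u x = (\<Sum>j=1..N. c j * \<phi> j x)"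
  shows "L2_inner G u v = (\<Sum>j=1..N. c j * L2_inner G (\<phi> j) v)"
proof -
  have "L2_inner G u v = (\<Sum>x\<in>inner_verts G. \<Sum>j=1..N. c j * (vweight G x * \<phi> j x * v x))"
    unfolding L2_inner_def using assms
    by (intro sum.cong) (auto simp: sum_distrib_left sum_distrib_right mult_ac)
  then show ?thesis by (subst (asm) sum.swap) (simp add: L2_inner_def sum_distrib_left)
qed

lemma orthonormal_expansion:
  assumes basis: "L2_orthonormal_basis G N \<phi>" and x: "x \<in> inner_verts G"
  shows "u x = (\<Sum>j=1..N. L2_inner G u (\<phi> j) * \<phi> j x)"
proof -
  obtain c where c: "\<forall>x\<in>inner_verts G. u x = (\<Sum>j=1..N. c j * \<phi> j x)"
    using basis unfolding L2_orthonormal_basis_def by blast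
  have "L2_inner G u (\<phi> i) = c i" if i: "i \<in> {1..N}" for i
  proof -
    have "L2_inner G u (\<phi> i) = (\<Sum>j=1..N. c j * L2_inner G (\<phi> j) (\<phi> i))"
      by (rule L2_inner_sum_left[OF c])
    also have "\<dots> = (\<Sum>j=1..N. if j = i then c j else 0)"
      using basis i unfolding L2_orthonormal_basis_def by (intro sum.cong) auto
    finally show ?thesis using i by simp
  qed
  then show ?thesis using c x by simp
qed

text \<open>Completeness, obtained by expanding the indicator function of \<open>y\<close>.\<close>

lemma orthonormal_completeness:
  assumes basis: "L2_orthonormal_basis G N \<phi>"
    and x: "x \<in> inner_verts G" and y: "y \<in> inner_verts G"
  shows "(\<Sum>j=1..N. \<phi> j x * \<phi> j y) = (if x = y then 1 / vweight G x else 0)"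
proof -
  let ?\<delta> = "\<lambda>v. if v = y then 1 else 0 :: real"
  have pos: "vweight G y > 0" using y vweight_pos by (simp add: verts_def)
  have "L2_inner G ?\<delta> (\<phi> j) = vweight G y * \<phi> j y" for j
  proof -
    have "L2_inner G ?\<delta> (\<phi> j)
        = (\<Sum>v\<in>inner_verts G. if v = y then vweight G v * \<phi> j v else 0)"
      unfolding L2_inner_def by (rule sum.cong) auto
    then show ?thesis using y finite_inner by simp
  qed
  then have "?\<delta> x = vweight G y * (\<Sum>j=1..N. \<phi> j x * \<phi> j y)"
    using orthonormal_expansion[OF basis x, of ?\<delta>] by (simp add: sum_distrib_left mult_ac)
  then show ?thesis using pos by (auto simp: field_simps split: if_splits)
qed

end

section \<open>Two graphs with the same boundary spectral data\<close>

locale isospectral_pair =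
  L: finite_weighted_bgraph G + R: finite_weighted_bgraph G'
  for G :: "'v bgraph" and G' :: "'w bgraph" +
  fixes \<Phi> :: "'v \<Rightarrow> 'w" and q :: "'v \<Rightarrow> real" and q' :: "'w \<Rightarrow> real"
    and N :: nat and \<kappa> :: "nat \<Rightarrow> real"
    and \<phi> :: "nat \<Rightarrow> 'v \<Rightarrow> real" and \<phi>' :: "nat \<Rightarrow> 'w \<Rightarrow> real"
  assumes inner_bij: "bij_betw \<Phi> (inner_verts G) (inner_verts G')"
    and bdry_bij: "bij_betw \<Phi> (bdry_verts G) (bdry_verts G')"
    and adj_iff: "x \<in> verts G \<Longrightarrow> y \<in> verts G \<Longrightarrow> adj G x y \<longleftrightarrow> adj G' (\<Phi> x) (\<Phi> y)"
    and bdry_eweight: "z \<in> bdry_verts G \<Longrightarrow> x \<in> inner_verts G \<Longrightarrow> adj G x z \<Longrightarrow>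
      eweight G {x, z} = eweight G' {\<Phi> x, \<Phi> z}"
    and triangle: "boundary_triangle_condition G" "boundary_triangle_condition G'"
    and two_points: "two_points_condition G'"
    and connected: "connected_bgraph G" "connected_bgraph G'"
    and bdry_ne: "bdry_verts G \<noteq> {}"
    and eigen: "j \<in> {1..N} \<Longrightarrow> x \<in> inner_verts G \<Longrightarrow>
      - laplacian G (\<phi> j) x + q x * \<phi> j x = \<kappa> j * \<phi> j x"
    and eigen': "j \<in> {1..N} \<Longrightarrow> x' \<in> inner_verts G' \<Longrightarrow>
      - laplacian G' (\<phi>' j) x' + q' x' * \<phi>' j x' = \<kappa> j * \<phi>' j x'"
    and neumann: "j \<in> {1..N} \<Longrightarrow> z \<in> bdry_verts G \<Longrightarrow> normal_deriv G (\<phi> j) z = 0"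
    and neumann': "j \<in> {1..N} \<Longrightarrow> z' \<in> bdry_verts G' \<Longrightarrow> normal_deriv G' (\<phi>' j) z' = 0"
    and basis: "L2_orthonormal_basis G N \<phi>"
    and basis': "L2_orthonormal_basis G' N \<phi>'"
    and bdry_data: "j \<in> {1..N} \<Longrightarrow> z \<in> bdry_verts G \<Longrightarrow> \<phi> j z = \<phi>' j (\<Phi> z)"
begin

abbreviation "I \<equiv> inner_verts G"
abbreviation "I' \<equiv> inner_verts G'"
abbreviation "B \<equiv> bdry_verts G"
abbreviation "B' \<equiv> bdry_verts G'"
abbreviation "\<mu> \<equiv> vweight G"
abbreviation "\<mu>' \<equiv> vweight G'"

lemma inner_image: "x \<in> I \<Longrightarrow> \<Phi> x \<in> I'"
  using inner_bij bij_betwE by blast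

lemma bdry_image: "z \<in> B \<Longrightarrow> \<Phi> z \<in> B'"
  using bdry_bij bij_betwE by blast

lemma weight_pos: "x \<in> I \<Longrightarrow> 0 < \<mu> x" "x \<in> I \<Longrightarrow> 0 < \<mu>' (\<Phi> x)"
  using L.vweight_pos R.vweight_pos inner_image by (auto simp: verts_def)

lemma sum_inner': "(\<Sum>x'\<in>I'. h x') = (\<Sum>x\<in>I. h (\<Phi> x))"
  using sum.reindex_bij_betw[OF inner_bij, of h] by simp

lemma sum_bdry': "(\<Sum>z'\<in>B'. h z') = (\<Sum>z\<in>B. h (\<Phi> z))"
  using sum.reindex_bij_betw[OF bdry_bij, of h] by simp

lemma bdry_conductance:
  assumes "x \<in> I" "z \<in> B"
  shows "conductance G' (\<Phi> x) (\<Phi> z) = conductance G x z"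
  using assms adj_iff[of x z] bdry_eweight[of z x] by (auto simp: conductance_def verts_def)

lemma bdry_inner_conductance: "z \<in> B \<Longrightarrow> inner_conductance G' (\<Phi> z) = inner_conductance G z"
  by (simp add: inner_conductance_def sum_inner' bdry_conductance)

lemma path_image: "(adj G ^^ s) x y \<Longrightarrow> (adj G' ^^ s) (\<Phi> x) (\<Phi> y)"
proof (induction s arbitrary: y)
  case 0
  then show ?case by auto
next
  case (Suc s)
  then obtain w where w: "(adj G ^^ s) x w" "adj G w y" by auto
  then have "adj G' (\<Phi> w) (\<Phi> y)" using L.adj_verts adj_iff by blast
  then show ?case using Suc.IH[OF w(1)] by auto
qed

text \<open>Up to the factor \<open>\<mu> x\<close>, the function \<open>transfer x\<close> is the image of the indicator of \<open>x\<close> under the unitary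
  map taking each \<open>\<phi> j\<close> to \<open>\<phi>' j\<close>.\<close>

definition transfer :: "'v \<Rightarrow> 'w \<Rightarrow> real" where
  "transfer x x' = (\<Sum>j=1..N. \<phi> j x * \<phi>' j x')"

text \<open>The waves of both graphs have the same coefficients, as these only involve the boundary spectral data
  and the conductances at the boundary.\<close>

lemma transfer_wave:
  assumes x: "x \<in> I" and z: "z \<in> B"
  shows "boundary_wave G q z t x
    = (\<Sum>x'\<in>I'. \<mu>' x' * transfer x x' * boundary_wave G' q' (\<Phi> z) t x')"
proof -
  have coeff: "L2_inner G (boundary_wave G q z t) (\<phi> j)
      = L2_inner G' (boundary_wave G' q' (\<Phi> z) t) (\<phi>' j)" if j: "j \<in> {1..N}" for j
  proof -
    have "L2_inner G (boundary_wave G q z t) (\<phi> j) = \<kappa> j ^ t * inner_conductance G z * \<phi> j z"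
      using eigen[OF j] neumann[OF j] z by (intro L.boundary_wave_coefficient) auto
    moreover have "L2_inner G' (boundary_wave G' q' (\<Phi> z) t) (\<phi>' j)
        = \<kappa> j ^ t * inner_conductance G' (\<Phi> z) * \<phi>' j (\<Phi> z)"
      using eigen'[OF j] neumann'[OF j] bdry_image[OF z]
      by (intro R.boundary_wave_coefficient) auto
    ultimately show ?thesis using bdry_inner_conductance bdry_data[OF j] z by simp
  qed
  have "boundary_wave G q z t x
      = (\<Sum>j=1..N. L2_inner G (boundary_wave G q z t) (\<phi> j) * \<phi> j x)"
    by (rule L.orthonormal_expansion[OF basis x])
  also have "\<dots> = (\<Sum>j=1..N. L2_inner G' (boundary_wave G' q' (\<Phi> z) t) (\<phi>' j) * \<phi> j x)"
    using coeff by simp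
  also have "\<dots> = (\<Sum>x'\<in>I'. \<mu>' x' * transfer x x' * boundary_wave G' q' (\<Phi> z) t x')"
    unfolding L2_inner_def transfer_def sum_distrib_left sum_distrib_right
    by (subst sum.swap) (simp add: mult_ac)
  finally show ?thesis .
qed

text \<open>An extreme point \<open>y'\<close> other than \<open>\<Phi> x\<close> of the support of \<open>transfer x\<close> together with \<open>\<Phi> x\<close> is nearer
  to some boundary vertex than \<open>\<Phi> x\<close> and the rest of the support. The wave from there would be seen by \<open>transfer x\<close> before
  the corresponding wave arrives at \<open>x\<close>. Including \<open>\<Phi> x\<close> in the set is what allows the arrival times at \<open>y'\<close> and
  at \<open>x\<close> to be compared.\<close>

lemma transfer_offdiag:
  assumes x: "x \<in> I" and x': "x' \<in> I'" "x' \<noteq> \<Phi> x"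
  shows "transfer x x' = 0"
proof (rule ccontr)
  assume nz: "transfer x x' \<noteq> 0"
  define S where "S = insert (\<Phi> x) {y' \<in> I'. transfer x y' \<noteq> 0}"
  have sub: "S \<subseteq> I'" using inner_image[OF x] by (auto simp: S_def)
  have "\<exists>a\<in>S. \<exists>b\<in>S. a \<noteq> b" using nz x' by (auto simp: S_def)
  from two_points[unfolded two_points_condition_def, rule_format, OF sub this]
  obtain a b where "a \<noteq> b" "extreme_point G' S a" "extreme_point G' S b" by blast
  then obtain y' where y': "extreme_point G' S y'" "y' \<noteq> \<Phi> x" by blast
  then have yS: "y' \<in> I'" "transfer x y' \<noteq> 0" by (auto simp: extreme_point_def S_def)
  have "\<Phi> x \<in> S" by (simp add: S_def)
  then obtain z1 n where z1: "z1 \<in> B'" "(adj G' ^^ n) y' z1"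
      "\<forall>v\<in>S - {y'}. \<forall>s\<le>n. \<not> (adj G' ^^ s) v z1"
    using y' by (metis R.extreme_point_path)
  obtain z' t where z': "z' \<in> B'" "0 < (-1) ^ t * boundary_wave G' q' z' t y'"
      and "\<forall>s\<le>t. \<not> (adj G' ^^ s) y' z'"
      and far: "\<forall>v\<in>S - {y'}. \<forall>s\<le>Suc t. \<not> (adj G' ^^ s) v z'"
    by (rule R.separating_wave[OF triangle(2) yS(1) z1, where q = q'])
  obtain z where z: "z \<in> B" "z' = \<Phi> z"
    using z'(1) bdry_bij by (auto simp: bij_betw_def)
  have others: "\<mu>' v * transfer x v * boundary_wave G' q' z' t v = 0" if "v \<in> I' - {y'}" for v
  proof (cases "transfer x v = 0")
    case False
    then have "boundary_wave G' q' z' t v = 0"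
      using R.boundary_wave_finite_speed[OF triangle(2), of v q' z' t] far that
      by (auto simp: S_def)
    then show ?thesis by simp
  qed simp
  have "boundary_wave G q z t x = (\<Sum>v\<in>I'. \<mu>' v * transfer x v * boundary_wave G' q' z' t v)"
    using transfer_wave[OF x z(1)] z(2) by simp
  also have "\<dots> = \<mu>' y' * transfer x y' * boundary_wave G' q' z' t y'"
    using sum.remove[OF R.finite_inner yS(1),
        of "\<lambda>v. \<mu>' v * transfer x v * boundary_wave G' q' z' t v"] others by simp
  also have "\<dots> \<noteq> 0"
    using yS z'(2) R.vweight_pos[of y'] by (auto simp: verts_def)
  finally obtain s where "s \<le> Suc t" "(adj G ^^ s) x z"
    using L.boundary_wave_finite_speed[OF triangle(1) x] by blast
  then show False using path_image[of s x z] far y'(2) z(2) \<open>\<Phi> x \<in> S\<close> by auto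
qed

definition ratio :: "'v \<Rightarrow> real" where
  "ratio x = transfer x (\<Phi> x)"

lemma transfer_sum:
  assumes "x \<in> I"
  shows "(\<Sum>x'\<in>I'. transfer x x' * h x') = ratio x * h (\<Phi> x)"
  using sum.remove[OF R.finite_inner inner_image[OF assms], of "\<lambda>x'. transfer x x' * h x'"]
    transfer_offdiag[OF assms] by (simp add: ratio_def)

lemma transfer_sum_left:
  assumes "y \<in> I"
  shows "(\<Sum>x\<in>I. h x * transfer x (\<Phi> y)) = h y * ratio y"
proof -
  have "transfer x (\<Phi> y) = 0" if "x \<in> I - {y}" for x
    using transfer_offdiag[of x "\<Phi> y"] inner_image[OF assms] that inner_bij assms
    by (auto simp: bij_betw_def inj_on_def)
  then show ?thesis
    using sum.remove[OF L.finite_inner assms, of "\<lambda>x. h x * transfer x (\<Phi> y)"]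
    by (simp add: ratio_def)
qed

lemma wave_ratio:
  assumes "x \<in> I" "z \<in> B"
  shows "boundary_wave G q z t x = \<mu>' (\<Phi> x) * ratio x * boundary_wave G' q' (\<Phi> z) t (\<Phi> x)"
  using transfer_wave[OF assms, of t] transfer_sum[OF assms(1),
      of "\<lambda>x'. \<mu>' x' * boundary_wave G' q' (\<Phi> z) t x'"] by (simp add: mult_ac)

text \<open>The unitary map preserves the norm of the indicator of \<open>x\<close>.\<close>

lemma ratio_square:
  assumes x: "x \<in> I"
  shows "\<mu> x * \<mu>' (\<Phi> x) * (ratio x)\<^sup>2 = 1"
proof -
  have expand: "L2_inner G' (transfer x) (\<phi>' j) = \<phi> j x" if j: "j \<in> {1..N}" for j
  proof -
    have "L2_inner G' (transfer x) (\<phi>' j) = (\<Sum>i=1..N. \<phi> i x * L2_inner G' (\<phi>' i) (\<phi>' j))"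
      by (rule R.L2_inner_sum_left) (simp add: transfer_def)
    also have "\<dots> = (\<Sum>i=1..N. if i = j then \<phi> i x else 0)"
      using basis' j unfolding L2_orthonormal_basis_def by (intro sum.cong) auto
    finally show ?thesis using j by simp
  qed
  have val: "\<phi> j x = \<mu>' (\<Phi> x) * ratio x * \<phi>' j (\<Phi> x)" if "j \<in> {1..N}" for j
    using expand[OF that] transfer_sum[OF x, of "\<lambda>x'. \<mu>' x' * \<phi>' j x'"]
    by (simp add: L2_inner_def mult_ac)
  have "1 / \<mu> x = (\<Sum>j=1..N. \<phi> j x * \<phi> j x)"
    using L.orthonormal_completeness[OF basis x x] by simp
  also have "\<dots> = (\<Sum>j=1..N. \<mu>' (\<Phi> x) * ratio x * (\<phi> j x * \<phi>' j (\<Phi> x)))"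
    using val by (intro sum.cong refl) (metis mult.assoc mult.commute)
  also have "\<dots> = \<mu>' (\<Phi> x) * ratio x * ratio x"
    by (simp add: ratio_def transfer_def sum_distrib_left)
  finally show ?thesis using weight_pos(1)[OF x] by (simp add: power2_eq_square field_simps)
qed

text \<open>A wave whose front is at \<open>\<Phi> x\<close> has there a known sign, which the corresponding wave
  at \<open>x\<close> shares.\<close>

lemma ratio_pos:
  assumes x: "x \<in> I"
  shows "0 < ratio x"
proof -
  obtain z0 where z0: "z0 \<in> B'" using bdry_ne bdry_image by blast
  have "(adj G')\<^sup>*\<^sup>* (\<Phi> x) z0"
    using connected(2) inner_image[OF x] z0 by (auto simp: connected_bgraph_def verts_def)
  then obtain n where n: "(adj G' ^^ n) (\<Phi> x) z0" by (metis rtranclp_imp_relpowp)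
  obtain z' t where z': "z' \<in> B'" "0 < (-1) ^ t * boundary_wave G' q' z' t (\<Phi> x)"
      "\<forall>s\<le>t. \<not> (adj G' ^^ s) (\<Phi> x) z'"
    by (rule R.separating_wave[OF triangle(2) inner_image[OF x] z0 n,
          where S = "{}" and q = q']) simp_all
  obtain z where z: "z \<in> B" "z' = \<Phi> z"
    using z'(1) bdry_bij by (auto simp: bij_betw_def)
  have "0 \<le> (-1) ^ t * boundary_wave G q z t x"
    using L.boundary_wave_front_nonneg[OF triangle(1) x] path_image z'(3) z(2) by blast
  also have "\<dots> = \<mu>' (\<Phi> x) * ratio x * ((-1) ^ t * boundary_wave G' q' z' t (\<Phi> x))"
    using wave_ratio[OF x z(1)] z(2) by simp
  finally have "0 \<le> ratio x"
    using z'(2) weight_pos(2)[OF x] by (auto simp: zero_le_mult_iff)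
  moreover have "ratio x \<noteq> 0" using ratio_square[OF x] by auto
  ultimately show ?thesis by simp
qed

text \<open>The two kernels are conjugate by the diagonal map, since the eigenfunctions \<open>\<phi> j\<close> and
  \<open>\<phi>' j\<close> that it matches have the same eigenvalue \<open>\<kappa> j\<close>.\<close>

lemma kernel_intertwining:
  assumes x: "x \<in> I" and y: "y \<in> I"
  shows "\<mu> x * ratio x * neumann_kernel G' q' (\<Phi> x) (\<Phi> y)
    = \<mu>' (\<Phi> y) * ratio y * neumann_kernel G q x y"
proof -
  have R: "(\<Sum>x'\<in>I'. neumann_kernel G' q' (\<Phi> y) x' * \<phi>' j x') = \<kappa> j * \<mu>' (\<Phi> y) * \<phi>' j (\<Phi> y)"
    and L: "(\<Sum>v\<in>I. neumann_kernel G q x v * \<phi> j v) = \<kappa> j * \<mu> x * \<phi> j x"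
    if j: "j \<in> {1..N}" for j
    using R.neumann_kernel_eigenfunction[of "\<Phi> y" "\<phi>' j" q' "\<kappa> j"] eigen'[OF j] neumann'[OF j]
      L.neumann_kernel_eigenfunction[of x "\<phi> j" q "\<kappa> j"] eigen[OF j] neumann[OF j]
      inner_image[OF y] x by blast+
  have "\<mu> x * ratio x * neumann_kernel G' q' (\<Phi> y) (\<Phi> x)
      = \<mu> x * (\<Sum>x'\<in>I'. transfer x x' * neumann_kernel G' q' (\<Phi> y) x')"
    by (simp add: transfer_sum[OF x])
  also have "\<dots> = \<mu> x * (\<Sum>j=1..N. \<phi> j x * (\<Sum>x'\<in>I'. neumann_kernel G' q' (\<Phi> y) x' * \<phi>' j x'))"
    unfolding transfer_def sum_distrib_left sum_distrib_right
    by (subst sum.swap) (simp add: mult_ac)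
  also have "\<dots> = (\<Sum>j=1..N. \<mu>' (\<Phi> y) * (\<kappa> j * \<mu> x * \<phi> j x) * \<phi>' j (\<Phi> y))"
    using R by (simp add: sum_distrib_left mult_ac)
  also have "\<dots> = (\<Sum>j=1..N. \<mu>' (\<Phi> y) * (\<Sum>v\<in>I. neumann_kernel G q x v * \<phi> j v) * \<phi>' j (\<Phi> y))"
    using L by simp
  also have "\<dots> = \<mu>' (\<Phi> y) * (\<Sum>v\<in>I. neumann_kernel G q x v * transfer v (\<Phi> y))"
    unfolding transfer_def sum_distrib_left sum_distrib_right
    by (subst sum.swap) (simp add: mult_ac)
  also have "\<dots> = \<mu>' (\<Phi> y) * ratio y * neumann_kernel G q x y"
    by (simp add: transfer_sum_left[OF y])
  finally show ?thesis by (simp add: neumann_kernel_commute)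
qed

section \<open>Recovering weights and potential\<close>

text \<open>With equal vertex weights the kernels agree, and so do their Schur complement terms, which only
  involve conductances at the boundary. The remaining off-diagonal part consists of the interior conductances;
  once these are known, the diagonal yields the potential.\<close>

lemma weights_and_potential:
  assumes agree: "\<And>x. x \<in> I \<Longrightarrow> \<mu> x = \<mu>' (\<Phi> x)"
  shows "inner_eweights_agree G G' \<Phi>" and "potentials_agree G \<Phi> q q'"
proof -
  have one: "\<mu> x * ratio x = 1" "\<mu>' (\<Phi> x) * ratio x = 1" if x: "x \<in> I" for x
  proof -
    have "(\<mu> x * ratio x)\<^sup>2 = 1"
      using ratio_square[OF x] agree[OF x] by (simp add: power2_eq_square mult_ac)
    moreover have "0 < \<mu> x * ratio x" using weight_pos(1)[OF x] ratio_pos[OF x] by simp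
    ultimately show "\<mu> x * ratio x = 1" by (simp add: power2_eq_1_iff)
    then show "\<mu>' (\<Phi> x) * ratio x = 1" using agree[OF x] by simp
  qed
  have kernel: "neumann_kernel G' q' (\<Phi> x) (\<Phi> y) = neumann_kernel G q x y"
    if "x \<in> I" "y \<in> I" for x y
    using kernel_intertwining[OF that] one that by simp
  have schur: "(\<Sum>z\<in>B'. conductance G' (\<Phi> x) z * conductance G' (\<Phi> y) z / inner_conductance G' z)
      = (\<Sum>z\<in>B. conductance G x z * conductance G y z / inner_conductance G z)"
    if "x \<in> I" "y \<in> I" for x y
    using that by (simp add: sum_bdry' bdry_conductance bdry_inner_conductance)
  have same: "conductance G' (\<Phi> x) (\<Phi> y) = conductance G x y" if xy: "x \<in> I" "y \<in> I" for x y
  proof (cases "x = y")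
    case True
    then show ?thesis using L.adj_irrefl R.adj_irrefl by (simp add: conductance_def)
  next
    case False
    then have "\<Phi> x \<noteq> \<Phi> y" using inner_bij xy by (auto simp: bij_betw_def inj_on_def)
    then show ?thesis using False kernel[OF xy] schur[OF xy] by (simp add: neumann_kernel_def)
  qed
  have edge: "eweight G {x, y} = eweight G' {\<Phi> x, \<Phi> y}"
    if "x \<in> I" "y \<in> verts G" "adj G x y" for x y
  proof -
    have "conductance G' (\<Phi> x) (\<Phi> y) = conductance G x y"
      using that same bdry_conductance by (auto simp: verts_def)
    moreover have "adj G' (\<Phi> x) (\<Phi> y)" using that adj_iff by (auto simp: verts_def)
    ultimately show ?thesis using that by (simp add: conductance_def)
  qed
  show "inner_eweights_agree G G' \<Phi>"
    unfolding inner_eweights_agree_def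
  proof (intro ballI impI)
    fix x y
    assume xy: "x \<in> verts G" "y \<in> verts G" "adj G x y \<and> (x \<in> I \<or> y \<in> I)"
    then have "eweight G {y, x} = eweight G' {\<Phi> y, \<Phi> x}" if "y \<in> I"
      using edge[OF that xy(1)] adj_commute[of G x y] by simp
    then show "eweight G {x, y} = eweight G' {\<Phi> x, \<Phi> y}"
      using xy edge by (auto simp: insert_commute)
  qed
  have "q x = q' (\<Phi> x)" if x: "x \<in> I" for x
  proof -
    have "(\<Sum>v\<in>verts G'. conductance G' (\<Phi> x) v) = (\<Sum>v\<in>verts G. conductance G x v)"
      using x same bdry_conductance
      by (simp add: R.sum_verts L.sum_verts sum_inner' sum_bdry')
    then have "\<mu> x * q x = \<mu>' (\<Phi> x) * q' (\<Phi> x)"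
      using kernel[OF x x] schur[OF x x] same[OF x x] by (simp add: neumann_kernel_def)
    then show ?thesis using agree[OF x] weight_pos[OF x] by simp
  qed
  then show "potentials_agree G \<Phi> q q'" by (simp add: potentials_agree_def)
qed

text \<open>At time \<open>0\<close> the wave at a neighbour of \<open>z\<close> has the value of the known conductance over the vertex weight.\<close>

lemma ratio_near_boundary:
  assumes x: "x \<in> I" and z: "z \<in> B" "adj G x z"
  shows "\<mu>' (\<Phi> x) * ratio x = 1"
proof -
  have "conductance G x z / \<mu> x = \<mu>' (\<Phi> x) * ratio x * (conductance G x z / \<mu>' (\<Phi> x))"
    using wave_ratio[OF x z(1), of 0] bdry_conductance[OF x z(1)] by simp
  then have "\<mu> x * ratio x = 1"
    using L.conductance_pos[OF z(2)] weight_pos[OF x] by (simp add: field_simps)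
  moreover have "\<mu> x * ratio x * (\<mu>' (\<Phi> x) * ratio x) = 1"
    using ratio_square[OF x] by (simp add: power2_eq_square mult_ac)
  ultimately show ?thesis by simp
qed

text \<open>Constants are harmonic for both operators; transporting them by the diagonal map shows
  that the map itself is given by a harmonic function.\<close>

lemma zero_potential_weights:
  assumes q0: "\<And>x. x \<in> I \<Longrightarrow> q x = 0" and q0': "\<And>x'. x' \<in> I' \<Longrightarrow> q' x' = 0"
    and x: "x \<in> I"
  shows "\<mu> x = \<mu>' (\<Phi> x)"
proof -
  define s where "s v = (if v \<in> I then \<mu>' (\<Phi> v) * ratio v else 1)" for v
  have near: "s v = 1" if "v \<in> bdry_nbhd G" for v
    using that ratio_near_boundary L.disjoint_verts by (auto simp: bdry_nbhd_def s_def)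
  have mean: "(\<Sum>y\<in>I. conductance G y z * s y) = inner_conductance G z * s z" if z: "z \<in> B" for z
  proof -
    have "conductance G y z * s y = conductance G y z" if "y \<in> I" for y
      using near[of y] z that by (auto simp: conductance_def bdry_nbhd_def)
    then have "(\<Sum>y\<in>I. conductance G y z * s y) = inner_conductance G z"
      unfolding inner_conductance_def by (rule sum.cong[OF refl])
    moreover have "s z = 1" using near z by (simp add: bdry_nbhd_def)
    ultimately show ?thesis by simp
  qed
  have harm: "(\<Sum>v\<in>verts G. conductance G v0 v * (s v - s v0)) = 0" if v0: "v0 \<in> I" for v0
  proof -
    have "(\<Sum>x'\<in>I'. neumann_kernel G' q' (\<Phi> v0) x' * 1) = 0"
      using R.neumann_kernel_apply[OF inner_image[OF v0], of "\<lambda>_. 1" q'] q0' inner_image[OF v0]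
      by (simp add: inner_conductance_def)
    then have "0 = \<mu> v0 * ratio v0 * (\<Sum>y\<in>I. neumann_kernel G' q' (\<Phi> v0) (\<Phi> y))"
      by (simp add: sum_inner')
    also have "\<dots> = (\<Sum>y\<in>I. neumann_kernel G q v0 y * s y)"
      unfolding sum_distrib_left
      using kernel_intertwining[OF v0] by (intro sum.cong) (auto simp: s_def mult_ac)
    also have "\<dots> = - (\<Sum>v\<in>verts G. conductance G v0 v * (s v - s v0))"
      using L.neumann_kernel_apply[OF v0 mean, of q] q0[OF v0] by simp
    finally show ?thesis by simp
  qed
  have "s x = 1"
    using L.harmonic_one_at_boundary_imp_one[OF connected(1) bdry_ne near harm] x
    by (simp add: verts_def)
  then have one: "\<mu>' (\<Phi> x) * ratio x = 1" using x by (simp add: s_def)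
  have "\<mu> x * ratio x * (\<mu>' (\<Phi> x) * ratio x) = 1"
    using ratio_square[OF x] by (simp add: power2_eq_square mult_ac)
  then have "\<mu> x * ratio x = \<mu>' (\<Phi> x) * ratio x" using one by simp
  then show ?thesis using ratio_pos[OF x] by simp
qed

end

lemma degree_invariant:
  assumes bij: "bij_betw \<Phi> (verts G) (verts G')"
    and adj: "\<forall>x\<in>verts G. \<forall>y\<in>verts G. adj G x y \<longleftrightarrow> adj G' (\<Phi> x) (\<Phi> y)"
    and x: "x \<in> verts G"
  shows "deg G x = deg G' (\<Phi> x)"
proof -
  have "bij_betw \<Phi> {y \<in> verts G. adj G x y} {y \<in> verts G'. adj G' (\<Phi> x) y}"
  proof (rule bij_betw_subset[OF bij])
    show "\<Phi> ` {y \<in> verts G. adj G x y} = {y \<in> verts G'. adj G' (\<Phi> x) y}"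
      unfolding bij_betw_imp_surj_on[OF bij, symmetric] using adj x by auto
  qed auto
  then show ?thesis unfolding deg_def by (rule bij_betw_same_card)
qed

theorem theorem2:
  fixes G :: "'v bgraph" and G' :: "'w bgraph"
    and q :: "'v \<Rightarrow> real" and q' :: "'w \<Rightarrow> real"
    and \<Phi>\<^sub>0 \<Phi> :: "'v \<Rightarrow> 'w"
  assumes "finite_weighted_bgraph G" and "finite_weighted_bgraph G'"
    and "strongly_connected_bgraph G" and "strongly_connected_bgraph G'"
    and "bdry_verts G \<noteq> {}" and "bdry_verts G' \<noteq> {}"
    and "two_points_condition G" and "two_points_condition G'"
    and "boundary_triangle_condition G" and "boundary_triangle_condition G'"
    and "spectrally_isomorphic G q G' q' \<Phi>\<^sub>0"
    and "bij_betw \<Phi> (verts G) (verts G')"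
    and "\<forall>z\<in>bdry_verts G. \<Phi> z = \<Phi>\<^sub>0 z"
    and "\<forall>x\<in>verts G. \<forall>y\<in>verts G. adj G x y \<longleftrightarrow> adj G' (\<Phi> x) (\<Phi> y)"
    and "\<forall>z\<in>bdry_verts G. vweight G z = vweight G' (\<Phi> z)"
    and "\<forall>z\<in>bdry_verts G. \<forall>x\<in>inner_verts G. adj G x z \<longrightarrow>
           eweight G {x, z} = eweight G' {\<Phi> x, \<Phi> z}"
  shows "(vweights_agree G G' \<Phi> \<longrightarrow>
            inner_eweights_agree G G' \<Phi> \<and> potentials_agree G \<Phi> q q')
       \<and> ((\<forall>x\<in>inner_verts G. q x = 0) \<and> (\<forall>x\<in>inner_verts G'. q' x = 0) \<longrightarrow>
            vweights_agree G G' \<Phi> \<and> inner_eweights_agree G G' \<Phi>)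
       \<and> ((\<forall>x\<in>verts G. vweight G x = real (deg G x)) \<and>
          (\<forall>x\<in>verts G'. vweight G' x = real (deg G' x)) \<longrightarrow>
            inner_eweights_agree G G' \<Phi> \<and> potentials_agree G \<Phi> q q')"
proof -
  note sp = assms(11)
  obtain N \<kappa> \<phi> \<kappa>' \<phi>' where data: "neumann_spectral_data G q N \<kappa> \<phi>"
      "neumann_spectral_data G' q' N \<kappa>' \<phi>'"
    and same: "\<forall>j\<in>{1..N}. \<kappa> j = \<kappa>' j \<and> (\<forall>z\<in>bdry_verts G. \<phi> j z = \<phi>' j (\<Phi>\<^sub>0 z))"
    using sp unfolding spectrally_isomorphic_def by blast
  have "bij_betw \<Phi>\<^sub>0 (bdry_verts G) (bdry_verts G')"
    using sp unfolding spectrally_isomorphic_def boundary_isomorphism_def by blast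
  then have bdry: "bij_betw \<Phi> (bdry_verts G) (bdry_verts G')"
    using assms(13) by (simp cong: bij_betw_cong)
  have diff: "verts H - bdry_verts H = inner_verts H" if "finite_weighted_bgraph H"
    for H :: "'x bgraph"
  proof -
    interpret finite_weighted_bgraph H by (fact that)
    show ?thesis using disjoint_verts by (auto simp: verts_def)
  qed
  have "bij_betw \<Phi> (verts G - bdry_verts G) (verts G' - bdry_verts G')"
    using assms(12) bdry by (intro bij_betw_DiffI) (auto simp: verts_def)
  then have inner: "bij_betw \<Phi> (inner_verts G) (inner_verts G')"
    using diff[OF assms(1)] diff[OF assms(2)] by simp
  interpret isospectral_pair G G' \<Phi> q q' N \<kappa> \<phi> \<phi>'
  proof (intro isospectral_pair.intro isospectral_pair_axioms.intro)
    show "adj G x y \<longleftrightarrow> adj G' (\<Phi> x) (\<Phi> y)" if "x \<in> verts G" "y \<in> verts G" for x y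
      using assms(14) that by blast
    show "eweight G {x, z} = eweight G' {\<Phi> x, \<Phi> z}"
      if "z \<in> bdry_verts G" "x \<in> inner_verts G" "adj G x z" for x z
      using assms(16) that by blast
    show "- laplacian G (\<phi> j) x + q x * \<phi> j x = \<kappa> j * \<phi> j x"
      if "j \<in> {1..N}" "x \<in> inner_verts G" for j x
      using data(1) that unfolding neumann_spectral_data_def by blast
    show "- laplacian G' (\<phi>' j) x' + q' x' * \<phi>' j x' = \<kappa> j * \<phi>' j x'"
      if "j \<in> {1..N}" "x' \<in> inner_verts G'" for j x'
    proof -
      have "\<kappa> j = \<kappa>' j" using same that(1) by blast
      then show ?thesis using data(2) that unfolding neumann_spectral_data_def by simp
    qed
    show "normal_deriv G (\<phi> j) z = 0" if "j \<in> {1..N}" "z \<in> bdry_verts G" for j z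
      using data(1) that unfolding neumann_spectral_data_def by blast
    show "normal_deriv G' (\<phi>' j) z' = 0" if "j \<in> {1..N}" "z' \<in> bdry_verts G'" for j z'
      using data(2) that unfolding neumann_spectral_data_def by blast
    show "L2_orthonormal_basis G N \<phi>" "L2_orthonormal_basis G' N \<phi>'"
      using data unfolding neumann_spectral_data_def by blast+
    show "\<phi> j z = \<phi>' j (\<Phi> z)" if "j \<in> {1..N}" "z \<in> bdry_verts G" for j z
      using same assms(13) that by simp
    show "connected_bgraph G" "connected_bgraph G'"
      by (rule strongly_connected_imp_connected[OF assms(3)])
        (rule strongly_connected_imp_connected[OF assms(4)])
  qed (fact inner bdry assms)+
  have part1: "inner_eweights_agree G G' \<Phi> \<and> potentials_agree G \<Phi> q q'"
    if "vweights_agree G G' \<Phi>"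
    using that weights_and_potential by (auto simp: vweights_agree_def verts_def)
  have "vweights_agree G G' \<Phi>"
    if "\<forall>x\<in>inner_verts G. q x = 0" "\<forall>x\<in>inner_verts G'. q' x = 0"
    using zero_potential_weights that assms(15) by (auto simp: vweights_agree_def verts_def)
  moreover have "vweights_agree G G' \<Phi>"
    if "\<forall>x\<in>verts G. vweight G x = real (deg G x)"
      "\<forall>x\<in>verts G'. vweight G' x = real (deg G' x)"
    using that degree_invariant[OF assms(12,14)] bij_betwE[OF assms(12)]
    by (simp add: vweights_agree_def)
  ultimately show ?thesis using part1 by blast
qed

end
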